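(* For every integer $m\ge1$, $$\frac{(-1)^{m-1}B_{2m}}{(2m)!}=\sum_{\nu=0}^{m-1}\sum_{p=0}^{\nu}(-1)^p\,\frac{2^{2+\nu-2m}\,\Gamma(2m-1-\nu)}{\Gamma(m)\,\nu!\,\Gamma(m-\nu)}\;b(\nu,p)\;G(2m-p,2m-p,\nu-p+1),$$ where, for integers $0\le p\le k$, $$b(k,p)=\sum_{j=0}^{k-p}\left\langle {k\atop j}\right\rangle\binom{k-j}{p},$$ and, for each positive integer $q$, the numbers $G(n,n,q)$, $n\ge1$, are given by $$\sum_{n=1}^\infty(-1)^nG(n,n,q)\,x^n=\Big(\frac{e^x-1}{x}\Big)^{-q}-1.$$
   Context: $B_{2m}$ denotes the Bernoulli numbers ($\frac{x}{e^x-1}=\sum_{n\ge0}B_n\frac{x^n}{n!}$). $\left\langle {n\atop k}\right\rangle$ denotes the Eulerian numbers: for $n\ge1$ and $0\le k\le n-1$, $\left\langle {n\atop k}\right\rangle=\sum_{j=0}^k(-1)^j\binom{n+1}{j}(k+1-j)^n$; further $\left\langle {0\atop 0}\right\rangle=1$, and $\left\langle {n\atop k}\right\rangle=0$ for $k\ge n$, $(n,k)\ne(0,0)$. *)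

theory Defs
  imports "HOL-Analysis.Analysis" "HOL-Computational_Algebra.Formal_Power_Series"
begin

text \<open>
  All generating functions are formal power series over the reals. Division of formal power
  series is division in the Euclidean ring, which cancels the common factor \<open>fps_X\<close>.
\<close>

definition bernoulli_number :: "nat \<Rightarrow> real" where
  "bernoulli_number n = fps_nth (fps_X / (fps_exp 1 - 1)) n * fact n"

definition eulerian_number :: "nat \<Rightarrow> nat \<Rightarrow> int" where
  "eulerian_number n k =
     (if n = 0 \<and> k = 0 then 1
      else if k \<ge> n then 0
      else (\<Sum>j=0..k. (-1) ^ j * int ((n + 1) choose j) * (int k + 1 - int j) ^ n))"

definition b_coeff :: "nat \<Rightarrow> nat \<Rightarrow> int" where
  "b_coeff k p = (\<Sum>j=0..k - p. eulerian_number k j * int ((k - j) choose p))"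

text \<open>
  \<open>G_diag n q\<close> is the number $G(n,n,q)$ (only the diagonal of the three-parameter family is
  needed); it is meaningful for \<open>n \<ge> 1\<close> and \<open>q \<ge> 1\<close>.
\<close>

definition G_diag :: "nat \<Rightarrow> nat \<Rightarrow> real" where
  "G_diag n q = (-1) ^ n * fps_nth (inverse (((fps_exp 1 - 1) / fps_X) ^ q) - 1) n"

lemma fps_exp_minus_1_div_X_nth_0:
  "fps_nth ((fps_exp 1 - 1) / fps_X :: real fps) 0 = 1"
  by simp

lemma bernoulli_number_egf:
  "Abs_fps (\<lambda>n. bernoulli_number n / fact n) * (fps_exp 1 - 1) = fps_X"
proof -
  have eq: "fps_exp 1 - 1 = fps_X * ((fps_exp 1 - 1) / fps_X :: real fps)"
    by (rule fps_ext) (simp add: fps_X_mult_nth)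
  have unit: "is_unit ((fps_exp 1 - 1) / fps_X :: real fps)"
    by simp
  have "fps_exp 1 - 1 dvd (fps_X :: real fps)"
    by (subst eq) (use unit in \<open>simp add: mult_unit_dvd_iff\<close>)
  moreover have "Abs_fps (\<lambda>n. bernoulli_number n / fact n) = fps_X / (fps_exp 1 - 1)"
    by (rule fps_ext) (simp add: bernoulli_number_def)
  ultimately show ?thesis
    by simp
qed

lemma G_diag_generating_function:
  assumes "q \<ge> 1"
  shows "Abs_fps (\<lambda>n. if n = 0 then 0 else (-1) ^ n * G_diag n q)
           = inverse (((fps_exp 1 - 1) / fps_X) ^ q) - 1"
  by (rule fps_ext) (simp add: G_diag_def fps_power_zeroth flip: mult.assoc power_add)

end

theory Submission
  imports Defs
begin

text \<open>
  Since $(-1)^p G(2m-p,2m-p,\nu-p+1)$ is the coefficient of $x^{2m-\nu-1}$ in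
  $(e^x-1)^{-(\nu-p+1)}$, the sum over $p$ extracts a coefficient of
  $(e^x-1)^{-\nu-1}\sum_j \left\langle{\nu\atop j}\right\rangle e^{(\nu-j)x}$. By the generating function
  of the Eulerian numbers this is $(-1)^\nu$ times the $\nu$-th derivative of $1/(e^x-1)$, so every
  inner sum is an explicit multiple of $B_{2m}/(2m)!$. What remains is an alternating binomial
  sum equal to $\int_0^1 (t(t-2))^{m-1}\,dt$ up to normalisation.
\<close>

section \<open>Eulerian numbers as power series coefficients\<close>

lemma one_minus_fps_X_power_nth:
  "fps_nth ((1 - fps_X :: 'a::comm_ring_1 fps) ^ n) k = (-1) ^ k * of_nat (n choose k)"
proof (induction n arbitrary: k)
  case 0
  then show ?case by (cases k) auto
next
  case (Suc n)
  have "(1 - fps_X :: 'a fps) ^ Suc n = (1 - fps_X) ^ n - fps_X * (1 - fps_X) ^ n"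
    by (simp add: algebra_simps)
  then show ?case
    by (cases k) (simp_all add: Suc.IH fps_X_mult_nth algebra_simps)
qed

text \<open>The Eulerian polynomial in its closed form: the alternating sum defining the Eulerian
  numbers is the Cauchy product of these two series, with no case split on
  \<open>k \<ge> n\<close>.\<close>

definition eulerian_fps :: "nat \<Rightarrow> int fps" where
  "eulerian_fps n = (1 - fps_X) ^ (n + 1) * Abs_fps (\<lambda>i. (int i + 1) ^ n)"

lemma eulerian_fps_nth:
  "fps_nth (eulerian_fps n) k =
     (\<Sum>j=0..k. (-1) ^ j * int ((n + 1) choose j) * (int k + 1 - int j) ^ n)"
  unfolding eulerian_fps_def fps_mult_nth one_minus_fps_X_power_nth
  by (intro sum.cong) (auto simp: of_nat_diff algebra_simps)

text \<open>The operator \<open>S + fps_X * fps_deriv S\<close> raises the exponent in the series of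
  \<open>(i + 1) ^ n\<close>; conjugating it by the power of \<open>1 - fps_X\<close> gives the
  recursion.\<close>

lemma eulerian_fps_Suc:
  "eulerian_fps (Suc n) =
     (1 - fps_X) * (eulerian_fps n + fps_X * fps_deriv (eulerian_fps n))
       + of_nat (n + 1) * fps_X * eulerian_fps n"
proof -
  define S where "S = Abs_fps (\<lambda>i. (int i + 1) ^ n)"
  define u :: "int fps" where "u = 1 - fps_X"
  have S_Suc: "Abs_fps (\<lambda>i. (int i + 1) ^ Suc n) = S + fps_X * fps_deriv S"
  proof (rule fps_ext)
    show "fps_nth (Abs_fps (\<lambda>i. (int i + 1) ^ Suc n)) k = fps_nth (S + fps_X * fps_deriv S) k" for k
      by (cases k) (simp_all add: S_def fps_X_mult_nth algebra_simps)
  qed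
  have du: "fps_deriv (u ^ (n + 1)) = - of_nat (n + 1) * u ^ n"
    by (simp only: fps_deriv_power') (simp add: u_def)
  have dA: "fps_deriv (eulerian_fps n) = u ^ (n + 1) * fps_deriv S - of_nat (n + 1) * u ^ n * S"
    unfolding eulerian_fps_def S_def[symmetric] u_def[symmetric] fps_deriv_mult du
    by (simp add: algebra_simps)
  have A: "eulerian_fps n = u ^ (n + 1) * S"
    by (simp add: eulerian_fps_def S_def u_def)
  have A_Suc: "eulerian_fps (Suc n) = u ^ (n + 2) * (S + fps_X * fps_deriv S)"
    by (simp only: eulerian_fps_def S_Suc u_def) simp
  show ?thesis
    unfolding u_def[symmetric] dA unfolding A A_Suc by (simp add: algebra_simps)
qed

lemma eulerian_fps_Suc_nth:
  "fps_nth (eulerian_fps (Suc n)) k =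
     (int k + 1) * fps_nth (eulerian_fps n) k
       + (if k = 0 then 0 else (int n + 1 - int k) * fps_nth (eulerian_fps n) (k - 1))"
proof -
  define A where "A = eulerian_fps n"
  have "eulerian_fps (Suc n) =
      A + fps_X * fps_deriv A - fps_X * (A + fps_X * fps_deriv A) + fps_const (int n + 1) * (fps_X * A)"
    unfolding eulerian_fps_Suc A_def[symmetric]
    by (simp add: algebra_simps fps_of_nat flip: fps_const_add)
  then have "fps_nth (eulerian_fps (Suc n)) k = fps_nth (A + fps_X * fps_deriv A
      - fps_X * (A + fps_X * fps_deriv A) + fps_const (int n + 1) * (fps_X * A)) k"
    by (rule arg_cong)
  \<comment> \<open>The term \<open>fps_X * (fps_X * fps_deriv A)\<close> shifts twice, so the
    indices 0 and 1 are boundary cases.\<close>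
  moreover have "k = 0 \<or> k = 1 \<or> (\<exists>i. k = Suc (Suc i))"
    by presburger
  ultimately show ?thesis
    by (auto simp: A_def[symmetric] fps_X_mult_nth; simp add: algebra_simps)
qed

lemma eulerian_fps_0: "eulerian_fps 0 = 1"
proof (rule fps_ext)
  show "fps_nth (eulerian_fps 0) k = fps_nth 1 k" for k
    by (cases k) (auto simp: eulerian_fps_def left_diff_distrib fps_X_mult_nth)
qed

text \<open>This matches the truncation in \<open>eulerian_number\<close>. In the recurrence, the
  factor \<open>int n + 1 - int k\<close> kills the boundary case \<open>k = Suc n\<close>; beyond
  it both coefficients vanish by induction.\<close>

lemma eulerian_fps_nth_eq_0: "k \<ge> n \<Longrightarrow> (n, k) \<noteq> (0, 0) \<Longrightarrow> fps_nth (eulerian_fps n) k = 0"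
proof (induction n arbitrary: k)
  case 0
  then show ?case by (simp add: eulerian_fps_0)
next
  case (Suc n)
  then have "k = Suc n \<or> n \<le> k - 1 \<and> k - 1 \<noteq> 0" by auto
  with Suc show ?case by (auto simp: eulerian_fps_Suc_nth)
qed

lemma eulerian_number_eq_fps_nth: "eulerian_number n k = fps_nth (eulerian_fps n) k"
  using eulerian_fps_nth_eq_0[of n k]
  by (auto simp: eulerian_number_def eulerian_fps_0 eulerian_fps_nth)

lemma eulerian_number_Suc_Suc:
  "eulerian_number (Suc n) (Suc k) =
     (int k + 2) * eulerian_number n (Suc k) + (int n - int k) * eulerian_number n k"
  by (simp add: eulerian_number_eq_fps_nth eulerian_fps_Suc_nth)

lemma eulerian_number_0_right: "eulerian_number n 0 = 1"
  by (simp add: eulerian_number_def)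

section \<open>Eulerian polynomials at the exponential series\<close>

text \<open>A unit whose inverse stands for x/(e^x - 1), so negative powers of e^x - 1 are handled
  without Laurent series.\<close>

definition expm1_quot :: "real fps" where
  "expm1_quot = (fps_exp 1 - 1) / fps_X"

lemma X_mult_expm1_quot: "fps_X * expm1_quot = fps_exp 1 - 1"
  by (rule fps_ext) (simp add: expm1_quot_def fps_X_mult_nth)

lemma expm1_quot_nth_0: "fps_nth expm1_quot 0 = 1"
  by (simp add: expm1_quot_def)

lemma inverse_expm1_quot: "inverse expm1_quot * expm1_quot = 1"
  by (rule inverse_mult_eq_1) (simp add: expm1_quot_nth_0)

definition eulerian_exp :: "nat \<Rightarrow> real fps" where
  "eulerian_exp n = (\<Sum>j=0..n. of_int (eulerian_number n j) * fps_exp 1 ^ (n - j))"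

lemma eulerian_exp_Suc:
  "eulerian_exp (Suc n) =
     of_nat (n + 1) * fps_exp 1 * eulerian_exp n - (fps_exp 1 - 1) * fps_deriv (eulerian_exp n)"
proof -
  define L :: "real fps" where "L = fps_exp 1"
  define a :: "nat \<Rightarrow> real fps" where "a j = of_int (eulerian_number n j)" for j
  have dL: "fps_deriv (L ^ k) = of_nat k * L ^ k" for k
    unfolding fps_deriv_power' by (cases k) (simp_all add: L_def)
  have Q: "eulerian_exp n = (\<Sum>j=0..n. a j * L ^ (n - j))"
    by (simp add: eulerian_exp_def a_def L_def)
  have dQ: "fps_deriv (eulerian_exp n) = (\<Sum>j=0..n. of_nat (n - j) * a j * L ^ (n - j))"
    unfolding Q by (simp add: fps_deriv_sum dL a_def mult_ac)
  have a_last: "a (Suc n) = 0"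
    by (simp add: a_def eulerian_number_def)
  \<comment> \<open>The term \<open>j = 0\<close> is split off; the Eulerian recurrence rewrites the
    others, and its \<open>n - j\<close> part is exactly the derivative.\<close>
  have "eulerian_exp (Suc n) = L ^ Suc n +
      (\<Sum>j=0..n. of_nat (j + 2) * a (Suc j) * L ^ (n - j) + of_nat (n - j) * a j * L ^ (n - j))"
    unfolding eulerian_exp_def
    by (subst sum.atLeast0_atMost_Suc_shift)
       (auto simp: eulerian_number_Suc_Suc eulerian_number_0_right a_def L_def of_nat_diff
          algebra_simps intro!: sum.cong)
  also have "\<dots> = L ^ Suc n + (\<Sum>j=0..n. of_nat (j + 2) * a (Suc j) * L ^ (n - j))
      + fps_deriv (eulerian_exp n)"
    by (simp add: sum.distrib dQ)
  also have "L ^ Suc n + (\<Sum>j=0..n. of_nat (j + 2) * a (Suc j) * L ^ (n - j)) =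
      (\<Sum>j=0..Suc n. of_nat (j + 1) * a j * L ^ (Suc n - j))"
    by (subst sum.atLeast0_atMost_Suc_shift) (simp add: a_def eulerian_number_0_right)
  also have "\<dots> = (\<Sum>j=0..n. of_nat (j + 1) * a j * L ^ (Suc n - j))"
    by (simp add: a_last)
  \<comment> \<open>Here \<open>j + 1 = (n + 1) - (n - j)\<close>, so a second copy of the
    derivative appears.\<close>
  also have "\<dots> = (\<Sum>j=0..n. L * (of_nat (n + 1) * (a j * L ^ (n - j)) - of_nat (n - j) * a j * L ^ (n - j)))"
    by (intro sum.cong) (auto simp: Suc_diff_le of_nat_diff algebra_simps)
  also have "\<dots> = of_nat (n + 1) * L * eulerian_exp n - L * fps_deriv (eulerian_exp n)"
    unfolding dQ unfolding Q
    by (simp only: sum_distrib_left sum_subtractf right_diff_distrib mult.assoc mult.left_commute)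
  finally show ?thesis
    by (simp add: L_def algebra_simps)
qed

text \<open>
  \<open>eulerian_quot n\<close> is \<open>(-1)^n X^(n+1)\<close> times the \<open>n\<close>-th derivative of the Laurent series
  \<open>1 / (exp X - 1)\<close>; the factor clears the pole.
\<close>

definition eulerian_quot :: "nat \<Rightarrow> real fps" where
  "eulerian_quot n = eulerian_exp n * inverse expm1_quot ^ (n + 1)"

lemma eulerian_quot_Suc:
  "eulerian_quot (Suc n) = of_nat (n + 1) * eulerian_quot n - fps_X * fps_deriv (eulerian_quot n)"
proof -
  define E where "E = expm1_quot"
  define I where "I = inverse expm1_quot"
  define L :: "real fps" where "L = fps_exp 1"
  define Q where "Q = eulerian_exp n"
  define P where "P = I ^ n"
  define N :: "real fps" where "N = of_nat (n + 1)"
  have EI: "E * I = 1"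
    using inverse_expm1_quot by (simp add: E_def I_def mult.commute)
  have XE: "L - 1 = fps_X * E"
    by (simp add: X_mult_expm1_quot E_def L_def)
  \<comment> \<open>Differentiating e^x - 1 = x E expresses \<open>L\<close> through
    \<open>E\<close> and its derivative.\<close>
  have "fps_deriv (L - 1) = fps_deriv (fps_X * E)"
    by (simp only: XE)
  then have L_eq: "L = E + fps_X * fps_deriv E"
    by (simp add: L_def)
  have "fps_deriv (E * I) = 0"
    by (simp add: EI)
  then have "I * (E * fps_deriv I + fps_deriv E * I) = 0"
    by simp
  then have dI: "fps_deriv I = - fps_deriv E * I * I"
    using EI by algebra
  have dpow: "fps_deriv (I ^ (n + 1)) = of_nat (n + 1) * (- fps_deriv E * I * I) * I ^ n"
    by (simp only: fps_deriv_power' dI) simp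
  have H: "eulerian_quot n = Q * (I * I ^ n)"
    by (simp add: eulerian_quot_def Q_def I_def)
  have dH: "fps_deriv (eulerian_quot n) =
      Q * (of_nat (n + 1) * (- fps_deriv E * I * I) * I ^ n) + fps_deriv Q * (I * I ^ n)"
    using dpow unfolding H by simp
  have H_Suc: "eulerian_quot (Suc n) =
      (of_nat (n + 1) * L * Q - (L - 1) * fps_deriv Q) * (I * I * I ^ n)"
    unfolding eulerian_quot_def eulerian_exp_Suc by (simp add: Q_def I_def L_def)
  \<comment> \<open>With \<open>I ^ n\<close> and \<open>n + 1\<close> abstracted, the claim is a
    polynomial identity modulo \<open>E * I = 1\<close>.\<close>
  show ?thesis
    unfolding H_Suc unfolding dH unfolding H XE unfolding L_eq P_def[symmetric] N_def[symmetric]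
    using EI by algebra
qed

text \<open>The operator x d/dx multiplies the coefficient at \<open>k\<close> by \<open>k\<close>,
  so each recursion step contributes one scalar factor.\<close>

lemma eulerian_quot_nth:
  "fps_nth (eulerian_quot n) k = (\<Prod>i=1..n. real i - real k) * fps_nth (inverse expm1_quot) k"
proof (induction n)
  case 0
  then show ?case
    by (simp add: eulerian_quot_def eulerian_exp_def eulerian_number_0_right)
next
  case (Suc n)
  have "fps_nth (eulerian_quot (Suc n)) k = (real (Suc n) - real k) * fps_nth (eulerian_quot n) k"
    unfolding eulerian_quot_Suc
    by (cases k) (simp_all add: fps_X_mult_nth algebra_simps flip: fps_of_nat)
  with Suc show ?case by simp
qed

section \<open>Bernoulli numbers and the inner sum over p\<close>

lemma bernoulli_number_eq:
  "bernoulli_number n / fact n = fps_nth (inverse expm1_quot) n"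
proof -
  define B where "B = Abs_fps (\<lambda>n. bernoulli_number n / fact n)"
  have "fps_X * (B * expm1_quot) = B * (fps_X * expm1_quot)"
    by (rule mult.left_commute)
  also have "\<dots> = fps_X * 1"
    by (simp add: X_mult_expm1_quot B_def bernoulli_number_egf)
  finally have "fps_X * (B * expm1_quot) = fps_X * 1" .
  then have "B * expm1_quot = 1"
    by (simp del: mult_1_right)
  then have "B = inverse expm1_quot"
    by (metis inverse_expm1_quot mult.assoc mult.commute mult_1)
  then show ?thesis
    by (metis B_def fps_nth_Abs_fps)
qed

text \<open>The numbers b(n,p) arise by expanding each power of e^x = 1 + (e^x - 1) binomially and
  collecting powers of e^x - 1.\<close>

lemma sum_b_coeff_power:
  "(\<Sum>p=0..n. of_int (b_coeff n p) * (fps_exp 1 - 1) ^ p) = eulerian_exp n"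
proof -
  define y :: "real fps" where "y = fps_exp 1 - 1"
  define a :: "nat \<Rightarrow> real fps" where "a j = of_int (eulerian_number n j)" for j
  have b: "of_int (b_coeff n p) = (\<Sum>j=0..n. a j * of_nat ((n - j) choose p))" if "p \<le> n" for p
  proof -
    have "of_int (b_coeff n p) = (\<Sum>j=0..n - p. a j * of_nat ((n - j) choose p))"
      by (simp add: b_coeff_def a_def)
    also have "\<dots> = (\<Sum>j=0..n. a j * of_nat ((n - j) choose p))"
      by (rule sum.mono_neutral_left) (use that in auto)
    finally show ?thesis .
  qed
  have pow: "fps_exp 1 ^ k = (\<Sum>p=0..n. of_nat (k choose p) * y ^ p)" if "k \<le> n" for k
  proof -
    have "fps_exp 1 ^ k = (y + 1) ^ k"
      by (simp add: y_def)
    also have "\<dots> = (\<Sum>p\<le>k. of_nat (k choose p) * y ^ p)"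
      by (simp add: binomial_ring)
    also have "\<dots> = (\<Sum>p=0..n. of_nat (k choose p) * y ^ p)"
      by (rule sum.mono_neutral_left) (use that in auto)
    finally show ?thesis .
  qed
  have "(\<Sum>p=0..n. of_int (b_coeff n p) * y ^ p) =
      (\<Sum>p=0..n. \<Sum>j=0..n. a j * (of_nat ((n - j) choose p) * y ^ p))"
    by (intro sum.cong) (auto simp: b sum_distrib_right mult.assoc)
  also have "\<dots> = (\<Sum>j=0..n. a j * (\<Sum>p=0..n. of_nat ((n - j) choose p) * y ^ p))"
    unfolding sum_distrib_left by (rule sum.swap)
  also have "\<dots> = eulerian_exp n"
    by (simp add: eulerian_exp_def a_def flip: pow)
  finally show ?thesis
    by (simp add: y_def)
qed

lemma sum_b_coeff_G_diag:
  assumes "even k" "n < k"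
  shows "(\<Sum>p=0..n. (-1) ^ p * real_of_int (b_coeff n p) * G_diag (k - p) (n - p + 1)) =
    fps_nth (eulerian_quot n) k"
proof -
  define I where "I = inverse expm1_quot"
  have EI: "expm1_quot * I = 1"
    using inverse_expm1_quot by (simp add: I_def mult.commute)
  have "(-1) ^ p * real_of_int (b_coeff n p) * G_diag (k - p) (n - p + 1) =
      fps_nth (of_int (b_coeff n p) * (fps_exp 1 - 1) ^ p * I ^ (n + 1)) k" if "p \<le> n" for p
  proof -
    \<comment> \<open>Cancelling \<open>p\<close> factors \<open>expm1_quot\<close> against
      \<open>I\<close> leaves \<open>fps_X ^ p\<close>, which shifts the coefficient index to
      \<open>k - p\<close>.\<close>
    have "(fps_exp 1 - 1) ^ p * I ^ (n + 1) = fps_X ^ p * (expm1_quot * I) ^ p * I ^ (n + 1 - p)"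
      using that by (simp add: power_mult_distrib mult.assoc flip: X_mult_expm1_quot power_add)
    then have cancel: "(fps_exp 1 - 1) ^ p * I ^ (n + 1) = fps_X ^ p * I ^ (n + 1 - p)"
      by (simp add: EI)
    have "fps_nth (of_int (b_coeff n p) * (fps_exp 1 - 1) ^ p * I ^ (n + 1)) k =
        fps_nth (fps_const (of_int (b_coeff n p)) * (fps_X ^ p * I ^ (n + 1 - p))) k"
      by (simp only: cancel mult.assoc fps_of_int)
    also have "\<dots> = of_int (b_coeff n p) * fps_nth (I ^ (n + 1 - p)) (k - p)"
      using assms that by (simp add: fps_X_power_mult_nth)
    also have "fps_nth (I ^ (n + 1 - p)) (k - p) = (-1) ^ p * G_diag (k - p) (n - p + 1)"
    proof -
      \<comment> \<open>Evenness of \<open>k\<close> makes the two signs agree; \<open>n < k\<close>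
        gives \<open>k - p > 0\<close>, where the subtracted 1 in \<open>G_diag\<close> has
        coefficient 0.\<close>
      have "(-1) ^ p * (-1) ^ (k - p) = (1::real)"
        using assms that by (simp flip: power_add)
      moreover have "n - p + 1 = n + 1 - p"
        using that by simp
      moreover have "inverse (expm1_quot ^ (n + 1 - p)) = I ^ (n + 1 - p)"
        by (simp add: I_def fps_inverse_power)
      ultimately show ?thesis
        using assms that unfolding G_diag_def expm1_quot_def[symmetric]
        by (simp flip: mult.assoc)
    qed
    finally show ?thesis
      by (simp add: mult_ac)
  qed
  then have "(\<Sum>p=0..n. (-1) ^ p * real_of_int (b_coeff n p) * G_diag (k - p) (n - p + 1)) =
      (\<Sum>p=0..n. fps_nth (of_int (b_coeff n p) * (fps_exp 1 - 1) ^ p * I ^ (n + 1)) k)"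
    by (intro sum.cong) auto
  also have "\<dots> = fps_nth (eulerian_quot n) k"
    by (simp only: eulerian_quot_def I_def fps_sum_nth[symmetric] sum_distrib_right[symmetric]
        sum_b_coeff_power)
  finally show ?thesis .
qed

section \<open>A falling factorial and the alternating binomial sum\<close>

lemma prod_diff_of_nat:
  assumes "n < k"
  shows "(\<Prod>i=1..n. real i - real k) = (-1) ^ n * fact (k - 1) / fact (k - 1 - n)"
  using assms
proof (induction n)
  case 0
  then show ?case by simp
next
  case (Suc n)
  define b where "b = real k - 1 - real n"
  have "b \<noteq> 0"
    using Suc.prems by (simp add: b_def)
  have "k - 1 - n = Suc (k - 1 - Suc n)"
    using Suc.prems by simp
  then have fact_eq: "fact (k - 1 - n) = b * (fact (k - 1 - Suc n) :: real)"
    using Suc.prems by (simp add: of_nat_diff b_def)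
  have "(\<Prod>i=1..Suc n. real i - real k) = (\<Prod>i=1..n. real i - real k) * (- b)"
    by (simp add: b_def)
  also have "\<dots> = (-1) ^ n * fact (k - 1) / fact (k - 1 - n) * (- b)"
    using Suc by simp
  also have "\<dots> = (-1) ^ Suc n * fact (k - 1) / fact (k - 1 - Suc n)"
    using \<open>b \<noteq> 0\<close> unfolding fact_eq by simp
  finally show ?case .
qed

text \<open>
  \<open>F n\<close> is the antiderivative of \<open>(t (t - 2))^n\<close> vanishing at 0; the recursion in \<open>n\<close> comes
  from the derivative of \<open>(t - 1) (t (t - 2))^(n+1)\<close>.
\<close>

lemma sum_choose_neg_2_power_div:
  "(\<Sum>\<nu>=0..n. real (n choose \<nu>) * (-2) ^ \<nu> / (2 * real n + 1 - real \<nu>)) =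
     (-4) ^ n * (fact n)\<^sup>2 / fact (2 * n + 1)"
proof -
  define F :: "nat \<Rightarrow> real \<Rightarrow> real" where
    "F n t = (\<Sum>\<nu>=0..n. real (n choose \<nu>) * (-2) ^ \<nu> * t ^ (2 * n + 1 - \<nu>) / real (2 * n + 1 - \<nu>))" for n t
  have dF: "(F n has_real_derivative (t * (t - 2)) ^ n) (at t)" for n t
  proof -
    have "(F n has_real_derivative (\<Sum>\<nu>=0..n. real (n choose \<nu>) * (-2) ^ \<nu> * t ^ (2 * n - \<nu>))) (at t)"
      unfolding F_def
      by (auto intro!: derivative_eq_intros sum.cong simp del: of_nat_Suc)
    \<comment> \<open>Pulling out \<open>t ^ n\<close> leaves the binomial expansion of
      \<open>(t - 2) ^ n\<close>.\<close>
    also have "(\<Sum>\<nu>=0..n. real (n choose \<nu>) * (-2) ^ \<nu> * t ^ (2 * n - \<nu>)) =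
        (\<Sum>\<nu>\<le>n. t ^ n * (real (n choose \<nu>) * (-2) ^ \<nu> * t ^ (n - \<nu>)))"
      by (intro sum.cong) (auto simp: mult_2 simp flip: power_add)
    also have "\<dots> = (t * (t - 2)) ^ n"
      using binomial_ring[of "-2" t n] by (simp add: power_mult_distrib flip: sum_distrib_left)
    finally show ?thesis .
  qed
  have F_0: "F n 0 = 0" for n
    by (auto simp: F_def intro!: sum.neutral)
  have rec: "(2 * real n + 3) * F (Suc n) 1 = - (2 * real n + 2) * F n 1" for n
  proof -
    \<comment> \<open>Since (t - 1)^2 = t(t - 2) + 1, the derivative of the last product cancels
      those of the first two terms. The product vanishes at 0 and 1, so constancy of
      \<open>R\<close> yields the recursion.\<close>
    define R where
      "R t = (2 * real n + 3) * F (Suc n) t + (2 * real n + 2) * F n t - (t - 1) * (t * (t - 2)) ^ Suc n" for t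
    have "(R has_real_derivative 0) (at t)" for t
      unfolding R_def
      by (rule derivative_eq_intros dF refl)+ (simp add: algebra_simps)
    then have "R 1 = R 0"
      using DERIV_isconst_all by blast
    then have "(2 * real n + 3) * F (Suc n) 1 + (2 * real n + 2) * F n 1 = 0"
      by (simp add: R_def F_0)
    then show ?thesis
      by linarith
  qed
  have "F n 1 = (-4) ^ n * (fact n)\<^sup>2 / fact (2 * n + 1)"
  proof (induction n)
    case 0
    then show ?case by (simp add: F_def)
  next
    case (Suc n)
    have "F (Suc n) 1 = - (2 * real n + 2) / (2 * real n + 3) * F n 1"
      using rec[of n] by (simp add: field_simps)
    \<comment> \<open>The ratio equals -4(n+1)^2 / ((2n+2)(2n+3)), matching the quotient of the
      closed forms.\<close>
    also have "\<dots> = (-4) ^ Suc n * (fact (Suc n))\<^sup>2 / fact (2 * Suc n + 1)"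
      unfolding Suc.IH by (simp add: divide_simps) (simp add: algebra_simps power2_eq_square)
    finally show ?case .
  qed
  moreover have "F n 1 = (\<Sum>\<nu>=0..n. real (n choose \<nu>) * (-2) ^ \<nu> / (2 * real n + 1 - real \<nu>))"
    unfolding F_def by (intro sum.cong) (auto simp: of_nat_diff)
  ultimately show ?thesis
    by simp
qed

section \<open>Evaluation of the double sum\<close>

theorem corollary5:
  fixes m :: nat
  assumes "m \<ge> 1"
  shows "(-1) ^ (m - 1) * bernoulli_number (2 * m) / fact (2 * m) =
    (\<Sum>\<nu>=0..m - 1. \<Sum>p=0..\<nu>.
       (-1) ^ p *
       (2 powi (2 + int \<nu> - 2 * int m) * Gamma (2 * real m - 1 - real \<nu>)
          / (Gamma (real m) * fact \<nu> * Gamma (real m - real \<nu>))) *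
       real_of_int (b_coeff \<nu> p) * G_diag (2 * m - p) (\<nu> - p + 1))"
proof -
  obtain n where m: "m = Suc n"
    using assms by (cases m) auto
  define \<beta> where "\<beta> = fps_nth (inverse expm1_quot) (2 * m)"
  define C where "C \<nu> = 2 powi (2 + int \<nu> - 2 * int m) * Gamma (2 * real m - 1 - real \<nu>)
          / (Gamma (real m) * fact \<nu> * Gamma (real m - real \<nu>))" for \<nu>
  have summand: "(\<Sum>p=0..\<nu>. (-1) ^ p * C \<nu> * real_of_int (b_coeff \<nu> p) * G_diag (2 * m - p) (\<nu> - p + 1)) =
      \<beta> * (fact (2 * n + 1) / (4 ^ n * (fact n)\<^sup>2)) *
        (real (n choose \<nu>) * (-2) ^ \<nu> / (2 * real n + 1 - real \<nu>))" if "\<nu> \<le> n" for \<nu>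
  proof -
    define d where "d = 2 * real n + 1 - real \<nu>"
    have "d \<noteq> 0"
      using that by (simp add: d_def)
    have C: "C \<nu> = 2 ^ \<nu> / 4 ^ n * fact (2 * n - \<nu>) / (fact n * fact \<nu> * fact (n - \<nu>))"
    proof -
      have "(2::real) powi (2 + int \<nu> - 2 * int m) = 2 powi (int \<nu> - int (2 * n))"
        by (simp add: m)
      also have "\<dots> = 2 powi int \<nu> / 2 powi int (2 * n)"
        by (rule power_int_diff) simp
      also have "\<dots> = 2 ^ \<nu> / 4 ^ n"
        by (simp only: power_int_of_nat power_mult) simp
      finally have "(2::real) powi (2 + int \<nu> - 2 * int m) = 2 ^ \<nu> / 4 ^ n" .
      moreover have "Gamma (2 * real m - 1 - real \<nu>) = fact (2 * n - \<nu>)"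
        using that Gamma_fact[of "2 * n - \<nu>", where ?'a = real] by (simp add: m of_nat_diff algebra_simps)
      moreover have "Gamma (real m) = fact n"
        using Gamma_fact[of n, where ?'a = real] by (simp add: m)
      moreover have "Gamma (real m - real \<nu>) = fact (n - \<nu>)"
        using that Gamma_fact[of "n - \<nu>", where ?'a = real] by (simp add: m of_nat_diff algebra_simps)
      ultimately show ?thesis
        by (simp add: C_def)
    qed
    have "(\<Sum>p=0..\<nu>. (-1) ^ p * C \<nu> * real_of_int (b_coeff \<nu> p) * G_diag (2 * m - p) (\<nu> - p + 1)) =
        C \<nu> * (\<Sum>p=0..\<nu>. (-1) ^ p * real_of_int (b_coeff \<nu> p) * G_diag (2 * m - p) (\<nu> - p + 1))"
      by (simp add: sum_distrib_left mult_ac)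
    also have "\<dots> = C \<nu> * (\<Prod>i=1..\<nu>. real i - real (2 * m)) * \<beta>"
      using that by (subst sum_b_coeff_G_diag) (auto simp: m eulerian_quot_nth \<beta>_def)
    also have "(\<Prod>i=1..\<nu>. real i - real (2 * m)) = (-1) ^ \<nu> * fact (2 * n + 1) / fact (2 * n + 1 - \<nu>)"
      using that by (subst prod_diff_of_nat) (auto simp: m)
    \<comment> \<open>Splitting off \<open>d\<close> lets the remaining factorial cancel the one in
      \<open>C \<nu>\<close>; the surviving \<open>d\<close> is the denominator of the binomial
      sum.\<close>
    also have "fact (2 * n + 1 - \<nu>) = d * (fact (2 * n - \<nu>) :: real)"
      using that by (simp add: d_def Suc_diff_le of_nat_diff algebra_simps)
    also have "C \<nu> * ((-1) ^ \<nu> * fact (2 * n + 1) / (d * fact (2 * n - \<nu>))) * \<beta> =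
        \<beta> * (fact (2 * n + 1) / (4 ^ n * (fact n)\<^sup>2)) * (real (n choose \<nu>) * (-2) ^ \<nu> / d)"
      using that \<open>d \<noteq> 0\<close>
      by (simp add: C binomial_fact power2_eq_square power_minus[of 2] divide_simps del: fact_Suc)
    finally show ?thesis
      unfolding d_def .
  qed
  have "(\<Sum>\<nu>=0..m - 1. \<Sum>p=0..\<nu>. (-1) ^ p * C \<nu> * real_of_int (b_coeff \<nu> p)
          * G_diag (2 * m - p) (\<nu> - p + 1)) =
      \<beta> * (fact (2 * n + 1) / (4 ^ n * (fact n)\<^sup>2)) *
        (\<Sum>\<nu>=0..n. real (n choose \<nu>) * (-2) ^ \<nu> / (2 * real n + 1 - real \<nu>))"
    unfolding sum_distrib_left by (rule sum.cong[OF _ summand]) (simp_all add: m)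
  \<comment> \<open>The prefactor cancels the closed form up to \<open>(-4) ^ n / 4 ^ n\<close>,
    which is the sign of the claim since \<open>n = m - 1\<close>.\<close>
  also have "\<dots> = \<beta> * (-1) ^ n"
    unfolding sum_choose_neg_2_power_div
    by (simp add: power_minus[of 4])
  also have "\<dots> = (-1) ^ (m - 1) * bernoulli_number (2 * m) / fact (2 * m)"
    unfolding \<beta>_def bernoulli_number_eq[symmetric] by (simp add: m del: fact_Suc)
  finally show ?thesis
    by (simp add: C_def)
qed

end
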